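(* Let $R$ and $S$ be two semirings. Then $\mathrm{rad}_m(R\times S)=\mathrm{rad}_m(R)\times\mathrm{rad}_m(S)$.
   Context: A semiring $(S,+,\cdot)$ is a set with $(S,+)$ a commutative monoid with identity $0$, $(S,\cdot)$ a semigroup (no multiplicative identity is assumed), multiplication distributing over addition on both sides, and $0s=s0=0$ for all $s$. $R\times S$ is the product semiring with componentwise operations. $\nabla_S=S\times S$. An $S$-semimodule is a right $S$-semimodule: a commutative monoid $(M,+,0_M)$ with a map $M\times S\to M$ such that $(m_1+m_2)s=m_1s+m_2s$, $m(s_1+s_2)=ms_1+ms_2$, $m(s_1s_2)=(ms_1)s_2$, $m0=0_M=0_Ms$. $M$ is called minimal if $MS\neq 0$ (i.e. $ms\ne 0_M$ for some $m\in M,s\in S$) and its only subsemimodules are $(0)$ and $M$. $\mathrm{ann}_S(M)=\{(s_1,s_2)\in S\times S\mid ms_1=ms_2 \text{ for all } m\in M\}$. For any semiring $S$, $\mathrm{rad}_m(S)$ is the intersection of $\mathrm{ann}_S(M)$ over all minimal $S$-semimodules $M$, and is $\nabla_S$ if there are none. For relations $\sigma$ on $R$ and $\eta$ on $S$, $\sigma\times\eta=\{((r_1,s_1),(r_2,s_2))\mid (r_1,r_2)\in\sigma \text{ and } (s_1,s_2)\in\eta\}$, a relation on $R\times S$. *)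

theory Defs
  imports "HOL-Library.Product_Plus" "HOL-Algebra.Ring"
begin

text \<open>
  A semiring (commutative additive monoid with absorbing zero, multiplicative semigroup, no unit
  required) is a type of class \<^class>\<open>semiring_0\<close>.  Addition and zero on products are already
  componentwise in the library; multiplication is not provided there.
\<close>

instantiation prod :: (times, times) times
begin

definition times_prod_def: "x * y = (fst x * fst y, snd x * snd y)"

instance ..

end

instance prod :: (semiring_0, semiring_0) semiring_0
  by standard (simp_all add: times_prod_def prod_eq_iff mult.assoc distrib_left distrib_right)

text \<open>
  Semimodules have explicit carriers.  The record extends the library's \<open>ring\<close> record only to
  reuse \<^const>\<open>abelian_monoid\<close>; its fields \<open>mult\<close> and \<open>one\<close> play no role.
\<close>

record ('m, 's) semimodule = "'m ring" +
  act :: "'m \<Rightarrow> 's \<Rightarrow> 'm" (infixl \<open>\<triangleleft>\<index>\<close> 70)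

locale semimodule = abelian_monoid M
  for M :: "('m, 's::semiring_0, 'z) semimodule_scheme" (structure) +
  assumes act_closed: "x \<in> carrier M \<Longrightarrow> x \<triangleleft> s \<in> carrier M"
    and act_add_left:
      "\<lbrakk>x \<in> carrier M; y \<in> carrier M\<rbrakk> \<Longrightarrow> (x \<oplus> y) \<triangleleft> s = x \<triangleleft> s \<oplus> y \<triangleleft> s"
    and act_add_right: "x \<in> carrier M \<Longrightarrow> x \<triangleleft> (s + t) = x \<triangleleft> s \<oplus> x \<triangleleft> t"
    and act_mult: "x \<in> carrier M \<Longrightarrow> x \<triangleleft> (s * t) = x \<triangleleft> s \<triangleleft> t"
    and act_zero_right: "x \<in> carrier M \<Longrightarrow> x \<triangleleft> 0 = \<zero>"
    and act_zero_left: "\<zero> \<triangleleft> s = \<zero>"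

definition subsemimodule :: "'m set \<Rightarrow> ('m, 's::semiring_0, 'z) semimodule_scheme \<Rightarrow> bool" where
  "subsemimodule N M \<longleftrightarrow> submonoid N (add_monoid M) \<and> (\<forall>x\<in>N. \<forall>s. x \<triangleleft>\<^bsub>M\<^esub> s \<in> N)"

definition minimal_semimodule :: "('m, 's::semiring_0, 'z) semimodule_scheme \<Rightarrow> bool" where
  "minimal_semimodule M \<longleftrightarrow> semimodule M
     \<and> (\<exists>x\<in>carrier M. \<exists>s. x \<triangleleft>\<^bsub>M\<^esub> s \<noteq> \<zero>\<^bsub>M\<^esub>)
     \<and> (\<forall>N. subsemimodule N M \<longrightarrow> N = {\<zero>\<^bsub>M\<^esub>} \<or> N = carrier M)"

definition ann :: "('m, 's::semiring_0, 'z) semimodule_scheme \<Rightarrow> ('s \<times> 's) set" where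
  "ann M = {(s, t). \<forall>x\<in>carrier M. x \<triangleleft>\<^bsub>M\<^esub> s = x \<triangleleft>\<^bsub>M\<^esub> t}"

text \<open>
  HOL cannot quantify over the type of elements of \<open>M\<close> inside a definition, so the intersection
  ranges over the minimal semimodules whose carrier is a set of elements of \<open>'s\<close>.  This loses
  nothing: a minimal \<open>M\<close> equals \<open>m S\<close> for some \<open>m\<close>, so it has an isomorphic copy of this kind.  See
  \<open>rad_m_subset_ann\<close> below, where \<open>M\<close> has an arbitrary type of elements.  If there is no minimal
  semimodule, the empty intersection is \<^const>\<open>UNIV\<close>, i.e. the relation \<open>\<nabla>\<close>.
\<close>

definition rad_m :: "'s::semiring_0 itself \<Rightarrow> ('s \<times> 's) set" where
  "rad_m _ = \<Inter> {ann M | M :: ('s, 's) semimodule. minimal_semimodule M}"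

definition rel_times :: "('a \<times> 'a) set \<Rightarrow> ('b \<times> 'b) set \<Rightarrow> (('a \<times> 'b) \<times> ('a \<times> 'b)) set"
    (infixr \<open>\<times>\<^sub>r\<close> 80) where
  "\<sigma> \<times>\<^sub>r \<eta> = {((r1, s1), (r2, s2)). (r1, r2) \<in> \<sigma> \<and> (s1, s2) \<in> \<eta>}"

lemma minimal_semimodule_cyclic:
  fixes M :: "('m, 's::semiring_0, 'z) semimodule_scheme"
  assumes "minimal_semimodule M"
  obtains m where "m \<in> carrier M" "carrier M = range (act M m)"
proof -
  interpret semimodule M using assms unfolding minimal_semimodule_def by blast
  obtain m s where m: "m \<in> carrier M" "m \<triangleleft>\<^bsub>M\<^esub> s \<noteq> \<zero>\<^bsub>M\<^esub>"
    using assms unfolding minimal_semimodule_def by blast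
  have "subsemimodule (range (act M m)) M"
    unfolding subsemimodule_def submonoid_def
    using m(1) by (auto simp: act_closed simp flip: act_mult act_add_right)
      (metis act_zero_right rangeI)
  moreover have "range (act M m) \<noteq> {\<zero>\<^bsub>M\<^esub>}" using m(2) by blast
  ultimately have "carrier M = range (act M m)"
    using assms unfolding minimal_semimodule_def by blast
  with m(1) that show thesis by blast
qed

lemma minimal_semimodule_transport:
  fixes M :: "('m, 's::semiring_0, 'z) semimodule_scheme" and g :: "'m \<Rightarrow> 'n"
  assumes min: "minimal_semimodule M" and inj: "inj_on g (carrier M)"
  obtains M' :: "('n, 's) semimodule" where "minimal_semimodule M'" "ann M' = ann M"
proof -
  interpret semimodule M using min unfolding minimal_semimodule_def by blast
  define h where "h = inv_into (carrier M) g"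
  have hg [simp]: "h (g x) = x" if "x \<in> carrier M" for x
    unfolding h_def using inj that by simp
  define M' :: "('n, 's) semimodule" where
    "M' = \<lparr>carrier = g ` carrier M, mult = undefined, one = undefined, zero = g \<zero>\<^bsub>M\<^esub>,
       add = (\<lambda>x y. g (h x \<oplus>\<^bsub>M\<^esub> h y)), act = (\<lambda>x s. g (h x \<triangleleft>\<^bsub>M\<^esub> s))\<rparr>"
  have sel [simp]: "carrier M' = g ` carrier M" "zero M' = g \<zero>\<^bsub>M\<^esub>"
    "add M' = (\<lambda>x y. g (h x \<oplus>\<^bsub>M\<^esub> h y))" "act M' = (\<lambda>x s. g (h x \<triangleleft>\<^bsub>M\<^esub> s))"
    by (simp_all add: M'_def)
  have g_eq: "g x = g y \<longleftrightarrow> x = y" if "x \<in> carrier M" "y \<in> carrier M" for x y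
    using inj that by (auto dest: inj_onD)
  have "abelian_monoid M'"
    by (rule abelian_monoidI) (auto simp: a_ac)
  then have "semimodule M'"
    by (intro semimodule.intro semimodule_axioms.intro)
      (auto simp: act_closed act_add_left act_add_right act_mult act_zero_right act_zero_left)
  moreover have "\<exists>x\<in>carrier M'. \<exists>s. x \<triangleleft>\<^bsub>M'\<^esub> s \<noteq> \<zero>\<^bsub>M'\<^esub>"
  proof -
    obtain m s where "m \<in> carrier M" "m \<triangleleft>\<^bsub>M\<^esub> s \<noteq> \<zero>\<^bsub>M\<^esub>"
      using min unfolding minimal_semimodule_def by blast
    then show ?thesis by (auto simp: g_eq act_closed)
  qed
  moreover have "N = {\<zero>\<^bsub>M'\<^esub>} \<or> N = carrier M'" if N: "subsemimodule N M'" for N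
  proof -
    have sub: "N \<subseteq> g ` carrier M"
      and add: "\<And>x y. x \<in> N \<Longrightarrow> y \<in> N \<Longrightarrow> g (h x \<oplus>\<^bsub>M\<^esub> h y) \<in> N"
      and zero: "g \<zero>\<^bsub>M\<^esub> \<in> N" and act: "\<And>x s. x \<in> N \<Longrightarrow> g (h x \<triangleleft>\<^bsub>M\<^esub> s) \<in> N"
      using N unfolding subsemimodule_def submonoid_def by auto
    define K where "K = {x \<in> carrier M. g x \<in> N}"
    have "subsemimodule K M"
      unfolding subsemimodule_def submonoid_def K_def
      using add zero act by (auto simp: act_closed) (metis hg)+
    then have "K = {\<zero>\<^bsub>M\<^esub>} \<or> K = carrier M"
      using min unfolding minimal_semimodule_def by blast
    moreover have "N = g ` K" using sub unfolding K_def by blast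
    ultimately show ?thesis by auto
  qed
  ultimately have "minimal_semimodule M'" unfolding minimal_semimodule_def by blast
  moreover have "ann M' = ann M" by (auto simp: ann_def g_eq act_closed)
  ultimately show thesis by (rule that)
qed

lemma rad_m_subset_ann:
  fixes M :: "('m, 's::semiring_0, 'z) semimodule_scheme"
  assumes "minimal_semimodule M"
  shows "rad_m TYPE('s) \<subseteq> ann M"
proof -
  obtain m where m: "carrier M = range (act M m)"
    using minimal_semimodule_cyclic[OF assms] by metis
  have "inj_on (inv_into UNIV (act M m)) (carrier M)"
    unfolding m by (rule inj_on_inv_into) simp
  then obtain M' :: "('s, 's) semimodule" where "minimal_semimodule M'" "ann M' = ann M"
    by (rule minimal_semimodule_transport[OF assms])
  then show ?thesis unfolding rad_m_def by blast
qed

end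

theory Submission
  imports Defs
begin

text \<open>
  Both inclusions come from moving minimal semimodules along semiring homomorphisms.

  A minimal semimodule over a factor becomes a semimodule over the product by restricting
  scalars along the projection.  The projection is surjective, so the same maps of \<open>M\<close> arise from
  scalars, and minimality survives.  Hence the radical of the product lies in the product of the
  radicals.

  For the converse the point is that a minimal semimodule \<open>M\<close> over \<open>R \<times> S\<close> only sees one of the
  two factors.  The elements killed by \<open>0 \<times> S\<close> form a subsemimodule, because \<open>0 \<times> S\<close> is a left
  ideal, so either \<open>0 \<times> S\<close> kills all of \<open>M\<close> or it kills only \<open>\<zero>\<close>.  In the second case every
  \<open>x \<triangleleft> (r, 0)\<close> vanishes, since it is killed by \<open>0 \<times> S\<close>; so \<open>R \<times> 0\<close> kills \<open>M\<close>.
  If, say, \<open>0 \<times> S\<close> kills \<open>M\<close>, then \<open>x \<triangleleft> (r, s) = x \<triangleleft> (r, 0)\<close>, so \<open>M\<close> is still minimal over \<open>R\<close>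
  after restriction along \<open>r \<mapsto> (r, 0)\<close>, and the radical of \<open>R\<close> controls its annihilator.
\<close>

definition restrict_scalars ::
    "('a \<Rightarrow> 'b) \<Rightarrow> ('m, 'b) semimodule \<Rightarrow> ('m, 'a) semimodule" where
  "restrict_scalars f M =
     \<lparr>carrier = carrier M, mult = mult M, one = one M, zero = zero M, add = add M,
      act = (\<lambda>x s. x \<triangleleft>\<^bsub>M\<^esub> f s)\<rparr>"

lemma restrict_scalars_simps [simp]:
  "carrier (restrict_scalars f M) = carrier M"
  "zero (restrict_scalars f M) = zero M"
  "add (restrict_scalars f M) = add M"
  "act (restrict_scalars f M) = (\<lambda>x s. x \<triangleleft>\<^bsub>M\<^esub> f s)"
  by (simp_all add: restrict_scalars_def)

lemma ann_restrict_scalars: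
  "(s, t) \<in> ann (restrict_scalars f M) \<longleftrightarrow> (f s, f t) \<in> ann M"
  by (simp add: ann_def)

text \<open>
  Surjectivity of \<open>f\<close> is asked for only up to the action on \<open>M\<close>: this weaker form covers
  the projections of a product and also the inclusion of a factor that alone acts on \<open>M\<close>.
  It guarantees that \<open>M\<close> has the same subsemimodules before and after restriction.
\<close>

lemma minimal_restrict_scalars:
  fixes f :: "'a::semiring_0 \<Rightarrow> 'b::semiring_0" and M :: "('m, 'b) semimodule"
  assumes min: "minimal_semimodule M"
    and f_zero: "f 0 = 0"
    and f_add: "\<And>s t. f (s + t) = f s + f t"
    and f_mult: "\<And>s t. f (s * t) = f s * f t"
    and onto: "\<And>b. \<exists>a. \<forall>x\<in>carrier M. x \<triangleleft>\<^bsub>M\<^esub> b = x \<triangleleft>\<^bsub>M\<^esub> f a"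
  shows "minimal_semimodule (restrict_scalars f M)"
proof -
  interpret semimodule M using min unfolding minimal_semimodule_def by blast
  let ?M = "restrict_scalars f M"
  have "abelian_monoid ?M"
    by (rule abelian_monoidI) (auto simp: a_ac)
  then have "semimodule ?M"
    by (intro semimodule.intro semimodule_axioms.intro)
      (auto simp: act_closed act_add_left act_add_right act_mult act_zero_right act_zero_left
        f_zero f_add f_mult)
  moreover have "\<exists>x\<in>carrier ?M. \<exists>s. x \<triangleleft>\<^bsub>?M\<^esub> s \<noteq> \<zero>\<^bsub>?M\<^esub>"
    using min onto unfolding minimal_semimodule_def by (metis restrict_scalars_simps(1,2,4))
  moreover have "N = {\<zero>\<^bsub>?M\<^esub>} \<or> N = carrier ?M" if N: "subsemimodule N ?M" for N
  proof -
    have sub: "N \<subseteq> carrier M" and act: "\<And>x a. x \<in> N \<Longrightarrow> x \<triangleleft>\<^bsub>M\<^esub> f a \<in> N"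
      using N unfolding subsemimodule_def submonoid_def by auto
    have "x \<triangleleft>\<^bsub>M\<^esub> b \<in> N" if "x \<in> N" for x b
      using onto[of b] act[OF that] sub that by (metis subsetD)
    with N have "subsemimodule N M"
      unfolding subsemimodule_def submonoid_def by auto
    then show ?thesis using min unfolding minimal_semimodule_def by simp
  qed
  ultimately show ?thesis unfolding minimal_semimodule_def by blast
qed

lemma rad_m_image_in_ann:
  fixes f :: "'a::semiring_0 \<Rightarrow> 'b::semiring_0" and M :: "('m, 'b) semimodule"
  assumes "minimal_semimodule M"
    and "f 0 = 0"
    and "\<And>s t. f (s + t) = f s + f t"
    and "\<And>s t. f (s * t) = f s * f t"
    and "\<And>b. \<exists>a. \<forall>x\<in>carrier M. x \<triangleleft>\<^bsub>M\<^esub> b = x \<triangleleft>\<^bsub>M\<^esub> f a"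
    and "(s, t) \<in> rad_m TYPE('a)"
  shows "(f s, f t) \<in> ann M"
  using rad_m_subset_ann[OF minimal_restrict_scalars[OF assms(1-5)]] assms(6)
  by (auto simp: ann_restrict_scalars)

lemma rad_m_surj_image:
  fixes f :: "'a::semiring_0 \<Rightarrow> 'b::semiring_0"
  assumes "f 0 = 0"
    and "\<And>s t. f (s + t) = f s + f t"
    and "\<And>s t. f (s * t) = f s * f t"
    and "surj f"
    and "(s, t) \<in> rad_m TYPE('a)"
  shows "(f s, f t) \<in> rad_m TYPE('b)"
proof -
  have "(f s, f t) \<in> ann M" if "minimal_semimodule M" for M :: "('b, 'b) semimodule"
    using that assms(1-3) _ assms(5)
  proof (rule rad_m_image_in_ann)
    show "\<exists>a. \<forall>x\<in>carrier M. x \<triangleleft>\<^bsub>M\<^esub> b = x \<triangleleft>\<^bsub>M\<^esub> f a" for b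
      using \<open>surj f\<close> by (metis surjD)
  qed
  then show ?thesis unfolding rad_m_def by blast
qed

text \<open>
  A left ideal is what is needed here: \<open>(x \<triangleleft> r) \<triangleleft> s = x \<triangleleft> (r * s)\<close>, so \<open>x \<triangleleft> r\<close> is killed by
  \<open>I\<close> whenever \<open>x\<close> is.
\<close>

lemma minimal_left_ideal_cases:
  assumes min: "minimal_semimodule M"
    and ideal: "\<And>r s. s \<in> I \<Longrightarrow> r * s \<in> I"
  obtains (kills_all) "\<And>x s. x \<in> carrier M \<Longrightarrow> s \<in> I \<Longrightarrow> x \<triangleleft>\<^bsub>M\<^esub> s = \<zero>\<^bsub>M\<^esub>"
    | (kills_zero) "\<And>x. x \<in> carrier M \<Longrightarrow> (\<And>s. s \<in> I \<Longrightarrow> x \<triangleleft>\<^bsub>M\<^esub> s = \<zero>\<^bsub>M\<^esub>) \<Longrightarrow> x = \<zero>\<^bsub>M\<^esub>"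
proof -
  interpret semimodule M using min unfolding minimal_semimodule_def by blast
  let ?K = "{x \<in> carrier M. \<forall>s\<in>I. x \<triangleleft>\<^bsub>M\<^esub> s = \<zero>\<^bsub>M\<^esub>}"
  have "subsemimodule ?K M"
    unfolding subsemimodule_def submonoid_def
    by (auto simp: act_closed act_add_left act_zero_left ideal simp flip: act_mult)
  then have "?K = {\<zero>\<^bsub>M\<^esub>} \<or> ?K = carrier M"
    using min unfolding minimal_semimodule_def by blast
  then show thesis
  proof
    assume "?K = {\<zero>\<^bsub>M\<^esub>}"
    then show thesis by (intro kills_zero) blast
  next
    assume "?K = carrier M"
    then show thesis by (intro kills_all) blast
  qed
qed

text \<open>
  The two factors annihilate each other, \<open>(r, 0) * (0, s) = 0\<close>, so \<open>M \<triangleleft> (R \<times> 0)\<close> lies in the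
  part of \<open>M\<close> killed by \<open>0 \<times> S\<close>.  If that part is trivial, \<open>R \<times> 0\<close> acts by zero; if it is all
  of \<open>M\<close>, \<open>0 \<times> S\<close> does.
\<close>

lemma minimal_over_product_cases:
  fixes M :: "('m, 'r::semiring_0 \<times> 's::semiring_0) semimodule"
  assumes min: "minimal_semimodule M"
  obtains (left) "\<And>x r s. x \<in> carrier M \<Longrightarrow> x \<triangleleft>\<^bsub>M\<^esub> (r, s) = x \<triangleleft>\<^bsub>M\<^esub> (r, 0)"
    | (right) "\<And>x r s. x \<in> carrier M \<Longrightarrow> x \<triangleleft>\<^bsub>M\<^esub> (r, s) = x \<triangleleft>\<^bsub>M\<^esub> (0, s)"
proof -
  interpret semimodule M using min unfolding minimal_semimodule_def by blast
  have split: "x \<triangleleft>\<^bsub>M\<^esub> (r, s) = x \<triangleleft>\<^bsub>M\<^esub> (r, 0) \<oplus>\<^bsub>M\<^esub> x \<triangleleft>\<^bsub>M\<^esub> (0, s)"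
    if "x \<in> carrier M" for x r s
    using act_add_right[OF that, of "(r, 0)" "(0, s)"] by simp
  have ideal: "a * b \<in> range (Pair 0)" if "b \<in> range (Pair 0)" for a b :: "'r \<times> 's"
    using that by (auto simp: times_prod_def)
  show thesis
  proof (rule minimal_left_ideal_cases[OF min, where I = "range (Pair 0)"])
    assume kills_all: "\<And>x b. x \<in> carrier M \<Longrightarrow> b \<in> range (Pair 0) \<Longrightarrow> x \<triangleleft>\<^bsub>M\<^esub> b = \<zero>\<^bsub>M\<^esub>"
    have "x \<triangleleft>\<^bsub>M\<^esub> (r, s) = x \<triangleleft>\<^bsub>M\<^esub> (r, 0)" if "x \<in> carrier M" for x r s
      using that kills_all[OF that, of "(0, s)"] split[OF that, of r s] by (simp add: act_closed)
    then show thesis by (rule left)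
  next
    assume kills_zero: "\<And>x. x \<in> carrier M \<Longrightarrow>
      (\<And>b. b \<in> range (Pair 0) \<Longrightarrow> x \<triangleleft>\<^bsub>M\<^esub> b = \<zero>\<^bsub>M\<^esub>) \<Longrightarrow> x = \<zero>\<^bsub>M\<^esub>"
    have R_kills: "x \<triangleleft>\<^bsub>M\<^esub> (r, 0) = \<zero>\<^bsub>M\<^esub>" if x: "x \<in> carrier M" for x r
    proof (rule kills_zero)
      show "x \<triangleleft>\<^bsub>M\<^esub> (r, 0) \<triangleleft>\<^bsub>M\<^esub> b = \<zero>\<^bsub>M\<^esub>" if "b \<in> range (Pair 0)" for b
        using that x
        by (auto simp: times_prod_def act_zero_right simp flip: act_mult zero_prod_def)
    qed (simp add: x act_closed)
    have "x \<triangleleft>\<^bsub>M\<^esub> (r, s) = x \<triangleleft>\<^bsub>M\<^esub> (0, s)" if "x \<in> carrier M" for x r s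
      using that R_kills[OF that, of r] split[OF that, of r s] by (simp add: act_closed)
    then show thesis by (rule right)
  qed (rule ideal)
qed

theorem theorem3p13:
  shows "rad_m TYPE('r::semiring_0 \<times> 's::semiring_0) = rad_m TYPE('r) \<times>\<^sub>r rad_m TYPE('s)"
proof (intro subset_antisym subrelI)
  fix p q :: "'r \<times> 's"
  assume pq: "(p, q) \<in> rad_m TYPE('r \<times> 's)"
  have "(fst p, fst q) \<in> rad_m TYPE('r)"
    using _ _ _ _ pq by (rule rad_m_surj_image) (simp_all add: times_prod_def)
  moreover have "(snd p, snd q) \<in> rad_m TYPE('s)"
    using _ _ _ _ pq by (rule rad_m_surj_image) (simp_all add: times_prod_def)
  ultimately show "(p, q) \<in> rad_m TYPE('r) \<times>\<^sub>r rad_m TYPE('s)"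
    by (simp add: rel_times_def case_prod_beta)
next
  fix p q :: "'r \<times> 's"
  assume "(p, q) \<in> rad_m TYPE('r) \<times>\<^sub>r rad_m TYPE('s)"
  then obtain r1 s1 r2 s2 where p: "p = (r1, s1)" and q: "q = (r2, s2)"
    and r: "(r1, r2) \<in> rad_m TYPE('r)" and s: "(s1, s2) \<in> rad_m TYPE('s)"
    by (auto simp: rel_times_def)
  have "(p, q) \<in> ann M" if min: "minimal_semimodule M" for M :: "('r \<times> 's, 'r \<times> 's) semimodule"
    using min
  proof (cases rule: minimal_over_product_cases)
    case left
    have "((r1, 0), (r2, 0)) \<in> ann M"
      using min _ _ _ _ r
    proof (rule rad_m_image_in_ann[where f = "\<lambda>r. (r, 0)"])
      show "\<exists>a. \<forall>x\<in>carrier M. x \<triangleleft>\<^bsub>M\<^esub> b = x \<triangleleft>\<^bsub>M\<^esub> (a, 0)" for b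
        using left by (metis prod.collapse)
    qed (simp_all add: times_prod_def zero_prod_def)
    then show ?thesis
      using left[of _ r1 s1] left[of _ r2 s2] by (simp add: p q ann_def)
  next
    case right
    have "((0, s1), (0, s2)) \<in> ann M"
      using min _ _ _ _ s
    proof (rule rad_m_image_in_ann[where f = "\<lambda>s. (0, s)"])
      show "\<exists>a. \<forall>x\<in>carrier M. x \<triangleleft>\<^bsub>M\<^esub> b = x \<triangleleft>\<^bsub>M\<^esub> (0, a)" for b
        using right by (metis prod.collapse)
    qed (simp_all add: times_prod_def zero_prod_def)
    then show ?thesis
      using right[of _ r1 s1] right[of _ r2 s2] by (simp add: p q ann_def)
  qed
  then show "(p, q) \<in> rad_m TYPE('r \<times> 's)" unfolding rad_m_def by blast
qed

end
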